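(* Let $d\ge 1$, let $\Phi=(\phi_{\mathbf a})_{\mathbf a\in\mathcal D}$ be a slicing self-affine IFS on $[0,1]^d$ with digit set $\mathcal D$, let $\Lambda_\Phi$ be the slicing self-affine sponge it generates, and let $K(M,\mathcal D)$ be the associated Sierpiński self-affine sponge of $\Phi$. Then there exists a bijection $F:\Lambda_\Phi\to K(M,\mathcal D)$ which is bi-Hölder continuous and satisfies $$F(\Lambda_\Phi\cap\partial[0,1]^d)\subset\partial[0,1]^d .$$
   Context: Slicing self-affine IFS. Fix $d\ge1$. For each $i\in\{1,\dots,d\}$ let $A_i=\{0,1,\dots,n_i-1\}$ with $n_i\ge 2$ an integer, and let $(\phi_{a,i})_{a\in A_i}$ be contracting similarities of $[0,1]$ into itself such that $[0,1)=\phi_{0,i}[0,1)\cup\cdots\cup\phi_{n_i-1,i}[0,1)$ is a partition of $[0,1)$ into intervals ordered from left to right. For $\mathbf a=(a_1,\dots,a_d)\in A=\prod_{i=1}^d A_i$ put $\phi_{\mathbf a}(x_1,\dots,x_d)=(\phi_{a_1,1}(x_1),\dots,\phi_{a_d,d}(x_d))$. For a nonempty $\mathcal D\subset A$ (the digit set), $\Phi=(\phi_{\mathbf a})_{\mathbf a\in\mathcal D}$ is called a slicing self-affine IFS, and its attractor $\Lambda_\Phi$ (the unique nonempty compact set with $\Lambda_\Phi=\bigcup_{\mathbf a\in\mathcal D}\phi_{\mathbf a}(\Lambda_\Phi)$) is called a slicing self-affine sponge. Associated Sierpiński self-affine sponge. With the same $n_1,\dots,n_d$ and the same $\mathcal D$,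 let $M=\mathrm{diag}(n_1,\dots,n_d)$; then $K(M,\mathcal D)$ is the attractor of the IFS $\{\lambda_{\mathbf d}(z)=M^{-1}(z+\mathbf d)\}_{\mathbf d\in\mathcal D}$. Bi-Hölder: there are constants $C\geq 1$ and $0<\alpha\le 1$ such that $C^{-1}|x-y|^{1/\alpha}\le|F(x)-F(y)|\le C|x-y|^{\alpha}$ for all $x,y$ in the domain. $\partial$ denotes the boundary in $\mathbb R^d$. *)

theory Defs
  imports "HOL-Analysis.Analysis"
begin

text \<open>
  A map of a subset \<open>S\<close> is represented by a total function of which only the values on \<open>S\<close>
  are relevant.
\<close>

definition contracting_similarity_on :: "'a::metric_space set \<Rightarrow> ('a \<Rightarrow> 'a) \<Rightarrow> bool" where
  "contracting_similarity_on S f \<longleftrightarrow>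
     f ` S \<subseteq> S \<and> (\<exists>r. 0 < r \<and> r < 1 \<and> (\<forall>x\<in>S. \<forall>y\<in>S. dist (f x) (f y) = r * dist x y))"

text \<open>
  Since the maps of an IFS on \<open>X\<close> have no meaning outside \<open>X\<close>, an attractor is required to be
  a subset of \<open>X\<close>.
\<close>

definition is_attractor :: "'a::metric_space set \<Rightarrow> ('a \<Rightarrow> 'a) set \<Rightarrow> 'a set \<Rightarrow> bool" where
  "is_attractor X fs L \<longleftrightarrow> compact L \<and> L \<noteq> {} \<and> L \<subseteq> X \<and> L = (\<Union>f\<in>fs. f ` L)"

definition attractor :: "'a::metric_space set \<Rightarrow> ('a \<Rightarrow> 'a) set \<Rightarrow> 'a set" where
  "attractor X fs = (THE L. is_attractor X fs L)"

text \<open>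
  One coordinate of a slicing IFS, with alphabet \<open>{..<m}\<close>. The images of \<open>{0..<1}\<close> are
  intervals because similarities of an interval are continuous. The last two conditions force
  every \<open>f a\<close> to be increasing, so no orientation is imposed separately.
\<close>

definition slicing_system :: "nat \<Rightarrow> (nat \<Rightarrow> real \<Rightarrow> real) \<Rightarrow> bool" where
  "slicing_system m f \<longleftrightarrow>
     2 \<le> m \<and>
     (\<forall>a<m. contracting_similarity_on {0..1} (f a)) \<and>
     disjoint_family_on (\<lambda>a. f a ` {0..<1}) {..<m} \<and>
     (\<Union>a<m. f a ` {0..<1}) = {0..<1} \<and>
     (\<forall>a<m. \<forall>b<m. a < b \<longrightarrow> (\<forall>x\<in>f a ` {0..<1}. \<forall>y\<in>f b ` {0..<1}. x < y))"

text \<open>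
  The dimension is the cardinality of the index type \<open>'d\<close>; the letters of a digit are its
  components.
\<close>

definition slicing_ifs :: "('d::finite \<Rightarrow> nat) \<Rightarrow> ('d \<Rightarrow> nat \<Rightarrow> real \<Rightarrow> real) \<Rightarrow> (nat^'d) set \<Rightarrow> bool" where
  "slicing_ifs n \<phi> D \<longleftrightarrow>
     (\<forall>i. slicing_system (n i) (\<phi> i)) \<and> D \<noteq> {} \<and> D \<subseteq> {a. \<forall>i. a $ i < n i}"

abbreviation unit_cube :: "(real^'d::finite) set" where
  "unit_cube \<equiv> cbox 0 1"

definition slicing_map :: "('d::finite \<Rightarrow> nat \<Rightarrow> real \<Rightarrow> real) \<Rightarrow> nat^'d \<Rightarrow> real^'d \<Rightarrow> real^'d" where
  "slicing_map \<phi> a x = (\<chi> i. \<phi> i (a $ i) (x $ i))"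

definition slicing_sponge :: "('d::finite \<Rightarrow> nat \<Rightarrow> real \<Rightarrow> real) \<Rightarrow> (nat^'d) set \<Rightarrow> (real^'d) set" where
  "slicing_sponge \<phi> D = attractor unit_cube (slicing_map \<phi> ` D)"

definition diag_matrix :: "('d::finite \<Rightarrow> nat) \<Rightarrow> real^'d^'d" where
  "diag_matrix n = (\<chi> i j. if i = j then real (n i) else 0)"

definition sierpinski_map :: "real^'d^'d \<Rightarrow> nat^'d \<Rightarrow> real^'d \<Rightarrow> real^'d::finite" where
  "sierpinski_map M d z = matrix_inv M *v (z + (\<chi> i. real (d $ i)))"

definition sierpinski_sponge :: "real^'d^'d \<Rightarrow> (nat^'d) set \<Rightarrow> (real^'d::finite) set" where
  "sierpinski_sponge M D = attractor UNIV (sierpinski_map M ` D)"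

definition bi_holder_on :: "'a::metric_space set \<Rightarrow> ('a \<Rightarrow> 'b::metric_space) \<Rightarrow> bool" where
  "bi_holder_on S F \<longleftrightarrow>
     (\<exists>C \<alpha>. 1 \<le> C \<and> 0 < \<alpha> \<and> \<alpha> \<le> 1 \<and>
        (\<forall>x\<in>S. \<forall>y\<in>S. inverse C * dist x y powr (1 / \<alpha>) \<le> dist (F x) (F y) \<and>
                      dist (F x) (F y) \<le> C * dist x y powr \<alpha>))"

text \<open>Justification of the definite description in the definition of \<open>attractor\<close>.\<close>

lemma is_attractor_subset:
  fixes X :: "'a::heine_borel set"
  assumes L1: "is_attractor X fs L1" and L2: "is_attractor X fs L2"
    and contr: "\<And>f. f \<in> fs \<Longrightarrow> \<exists>c<1. \<forall>x\<in>X. \<forall>y\<in>X. dist (f x) (f y) \<le> c * dist x y"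
  shows "L1 \<subseteq> L2"
proof -
  have L: "compact L1" "L1 \<noteq> {}" "L1 \<subseteq> X" "compact L2" "L2 \<noteq> {}" "L2 \<subseteq> X"
    using L1 L2 by (auto simp: is_attractor_def)
  have "continuous_on L1 (\<lambda>x. infdist x L2)"
    by (intro continuous_intros)
  then obtain x where x: "x \<in> L1" "\<And>y. y \<in> L1 \<Longrightarrow> infdist y L2 \<le> infdist x L2"
    using continuous_attains_sup[OF L(1,2)] by blast
  obtain f y where fy: "f \<in> fs" "y \<in> L1" "x = f y"
    using L1 x(1) unfolding is_attractor_def by blast
  obtain z where z: "z \<in> L2" "infdist y L2 = dist y z"
    using infdist_attains_inf[OF compact_imp_closed[OF L(4)] L(5)] by blast
  obtain c where c: "c < 1" "dist (f y) (f z) \<le> c * dist y z"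
    using contr[OF fy(1)] fy(2) z(1) L(3,6) by blast
  have "f z \<in> L2"
    using L2 fy(1) z(1) unfolding is_attractor_def by blast
  then have "infdist x L2 \<le> c * infdist y L2"
    using infdist_le[of "f z" L2 "f y"] c(2) z(2) fy(3) by simp
  then have "infdist y L2 \<le> c * infdist y L2"
    using x(2)[OF fy(2)] by simp
  moreover have "(1 - c) * infdist y L2 \<ge> 0"
    using c(1) infdist_nonneg[of y L2] by simp
  ultimately have "(1 - c) * infdist y L2 = 0"
    by (simp add: algebra_simps)
  then have "infdist y L2 = 0"
    using c(1) by simp
  with \<open>infdist x L2 \<le> c * infdist y L2\<close> have "infdist x L2 \<le> 0"
    by simp
  then have "infdist w L2 = 0" if "w \<in> L1" for w
    using x(2)[OF that] infdist_nonneg[of w L2] by linarith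
  then show ?thesis
    using in_closed_iff_infdist_zero[OF compact_imp_closed[OF L(4)] L(5)] by blast
qed

lemma is_attractor_exists:
  fixes X :: "'a::heine_borel set"
  assumes fs: "finite fs" "fs \<noteq> {}"
    and cont: "\<And>f. f \<in> fs \<Longrightarrow> continuous_on Y f"
    and Y: "compact Y" "Y \<noteq> {}" "Y \<subseteq> X" "\<And>f. f \<in> fs \<Longrightarrow> f ` Y \<subseteq> Y"
  shows "\<exists>L. is_attractor X fs L"
proof -
  define W where "W = (\<lambda>S. \<Union>f\<in>fs. f ` S)"
  define A where "A = (\<lambda>k. (W ^^ k) Y)"
  have A0: "A 0 = Y" and ASuc: "\<And>k. A (Suc k) = W (A k)"
    by (simp_all add: A_def)
  have mono: "W S \<subseteq> W T" if "S \<subseteq> T" for S T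
    using that unfolding W_def by blast
  have "A (Suc k) \<subseteq> A k" for k
  proof (induction k)
    case 0
    then show ?case using Y(4) unfolding ASuc A0 W_def by blast
  next
    case (Suc k)
    then show ?case using mono ASuc by metis
  qed
  then have dec: "A n \<subseteq> A m" if "m \<le> n" for m n
    using lift_Suc_antimono_le[of A] that by blast
  then have AY: "A k \<subseteq> Y" for k
    using A0 by (metis le0)
  have ne: "A k \<noteq> {}" for k
    by (induction k) (use Y(2) fs(2) in \<open>auto simp: A0 ASuc W_def\<close>)
  have comp: "compact (A k)" for k
  proof (induction k)
    case 0
    then show ?case using Y(1) A0 by simp
  next
    case (Suc k)
    then show ?case unfolding ASuc W_def
      using fs(1) cont AY by (intro compact_UN compact_continuous_image) (auto intro: continuous_on_subset)
  qed
  define L where "L = (\<Inter>k. A k)"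
  have "L \<noteq> {}"
    unfolding L_def by (rule compact_nest) (use comp ne dec in auto)
  moreover have "compact L"
    unfolding L_def by (intro compact_Inter) (use comp in auto)
  moreover have "L \<subseteq> X"
    using AY Y(3) unfolding L_def by blast
  moreover have "W L \<subseteq> L"
  proof -
    have "W L \<subseteq> A k" for k
    proof -
      have "W L \<subseteq> A (Suc k)"
        unfolding ASuc by (rule mono) (auto simp: L_def)
      then show ?thesis using dec[of k "Suc k"] by auto
    qed
    then show ?thesis unfolding L_def by blast
  qed
  moreover have "L \<subseteq> W L"
  proof
    fix x assume x: "x \<in> L"
    then have "\<exists>f\<in>fs. x \<in> f ` A k" for k
      using ASuc[of k] unfolding L_def W_def by blast
    then obtain g where g: "\<And>k. g k \<in> fs" "\<And>k. x \<in> g k ` A k"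
      by metis
    have "finite (range g)"
      using g(1) fs(1) by (meson finite_subset image_subsetI)
    then obtain k0 where "infinite {k \<in> UNIV. g k = g k0}"
      using pigeonhole_infinite[OF infinite_UNIV_nat] by blast
    then obtain f where f: "f \<in> fs" "infinite {k. g k = f}"
      using g(1)[of k0] by simp
    have xf: "x \<in> f ` A k" for k
    proof -
      obtain m where "m \<ge> k" "g m = f"
        using f(2) unfolding infinite_nat_iff_unbounded_le by auto
      then show ?thesis using g(2)[of m] dec[of k m] by auto
    qed
    define B where "B = (\<lambda>k. A k \<inter> f -` {x})"
    have "B k \<noteq> {}" for k
      using xf[of k] unfolding B_def by blast
    moreover have "compact (B k)" for k
    proof -
      have "continuous_on (A k) f"
        using cont[OF f(1)] AY continuous_on_subset by blast
      then have "closed (A k \<inter> f -` {x})"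
        by (rule continuous_closed_preimage) (use comp compact_imp_closed in auto)
      then have "compact (A k \<inter> (A k \<inter> f -` {x}))"
        by (rule compact_Int_closed[OF comp])
      then show ?thesis unfolding B_def by (simp add: Int_assoc[symmetric])
    qed
    ultimately have "(\<Inter>k. B k) \<noteq> {}"
      using dec by (intro compact_nest) (auto simp: B_def dest: subsetD[OF dec])
    then obtain y where "\<And>k. y \<in> B k" by blast
    then have "y \<in> L" "f y = x" unfolding B_def L_def by auto
    then show "x \<in> W L" using f(1) unfolding W_def by blast
  qed
  ultimately show ?thesis
    unfolding is_attractor_def W_def by (intro exI[of _ L]) auto
qed

lemma is_attractor_attractor:
  fixes X :: "'a::heine_borel set"
  assumes fs: "finite fs" "fs \<noteq> {}"
    and contr: "\<And>f. f \<in> fs \<Longrightarrow> \<exists>c<1. \<forall>x\<in>X. \<forall>y\<in>X. dist (f x) (f y) \<le> c * dist x y"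
    and Y: "compact Y" "Y \<noteq> {}" "Y \<subseteq> X" "\<And>f. f \<in> fs \<Longrightarrow> f ` Y \<subseteq> Y"
  shows "is_attractor X fs (attractor X fs)"
proof -
  have "continuous_on Y f" if f: "f \<in> fs" for f
  proof -
    obtain c where c: "c < 1" "\<forall>x\<in>X. \<forall>y\<in>X. dist (f x) (f y) \<le> c * dist x y"
      using contr[OF f] by blast
    have "dist (f x) (f y) \<le> 1 * dist x y" if "x \<in> Y" "y \<in> Y" for x y
      using c Y(3) that mult_right_mono[of c 1 "dist x y"] by force
    then show ?thesis
      by (intro lipschitz_on_continuous_on[of 1]) (simp add: lipschitz_on_def)
  qed
  then have "\<exists>L. is_attractor X fs L"
    using is_attractor_exists[OF fs _ Y] by blast
  moreover have "L1 = L2" if "is_attractor X fs L1" "is_attractor X fs L2" for L1 L2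
    using is_attractor_subset[OF that contr] is_attractor_subset[OF that(2,1) contr] by blast
  ultimately show ?thesis
    unfolding attractor_def by (metis (mono_tags, lifting) theI)
qed

lemma mem_unit_cube: "x \<in> unit_cube \<longleftrightarrow> (\<forall>i. 0 \<le> x $ i \<and> x $ i \<le> 1)"
  by (simp add: mem_box_cart)

lemma unit_cube_ne: "unit_cube \<noteq> {}"
  using mem_unit_cube[of 0] by auto

lemma dist_le_componentwise_cart:
  fixes x y u v :: "real^'d::finite"
  assumes "\<And>i. \<bar>x $ i - y $ i\<bar> \<le> c * \<bar>u $ i - v $ i\<bar>" and "0 \<le> c"
  shows "dist x y \<le> c * dist u v"
proof -
  have "norm (x - y) \<le> norm (c *\<^sub>R (u - v))"
    by (rule norm_le_componentwise_cart) (use assms in \<open>simp add: abs_mult\<close>)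
  then show ?thesis using assms(2) by (simp add: dist_norm)
qed

lemma finite_digits:
  assumes "slicing_ifs n \<phi> D"
  shows "finite D"
proof -
  have "(\<lambda>a i. a $ i) ` D \<subseteq> PiE UNIV (\<lambda>i. {..<n i})"
    using assms by (auto simp: slicing_ifs_def)
  moreover have "inj_on (\<lambda>a i. a $ i) D"
    by (auto simp: inj_on_def vec_eq_iff fun_eq_iff)
  ultimately show ?thesis
    by (meson finite_PiE finite_UNIV finite_imageD finite_lessThan finite_subset finite)
qed

lemma is_attractor_slicing_sponge:
  assumes "slicing_ifs n \<phi> D"
  shows "is_attractor unit_cube (slicing_map \<phi> ` D) (slicing_sponge \<phi> D)"
  unfolding slicing_sponge_def
proof (rule is_attractor_attractor)
  show "finite (slicing_map \<phi> ` D)" "slicing_map \<phi> ` D \<noteq> {}"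
    using finite_digits[OF assms] assms by (auto simp: slicing_ifs_def)
  have sim: "contracting_similarity_on {0..1} (\<phi> i (a $ i))" if "a \<in> D" for a i
    using assms that by (auto simp: slicing_ifs_def slicing_system_def)
  show "f ` unit_cube \<subseteq> unit_cube" if f: "f \<in> slicing_map \<phi> ` D" for f
  proof -
    obtain a where a: "a \<in> D" "f = slicing_map \<phi> a" using f by blast
    have "\<phi> i (a $ i) t \<in> {0..1}" if "t \<in> {0..1}" for i t
      using sim[OF a(1), of i] that unfolding contracting_similarity_on_def by blast
    then show ?thesis
      by (auto simp: a(2) slicing_map_def mem_unit_cube)
  qed
  show "\<exists>c<1. \<forall>x\<in>unit_cube. \<forall>y\<in>unit_cube. dist (f x) (f y) \<le> c * dist x y"
    if f: "f \<in> slicing_map \<phi> ` D" for f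
  proof -
    obtain a where a: "a \<in> D" "f = slicing_map \<phi> a" using f by blast
    obtain r where r: "\<And>i. 0 < r i" "\<And>i. r i < 1"
      "\<And>i s t. s \<in> {0..1} \<Longrightarrow> t \<in> {0..1} \<Longrightarrow> dist (\<phi> i (a $ i) s) (\<phi> i (a $ i) t) = r i * dist s t"
      using sim[OF a(1)] unfolding contracting_similarity_on_def by metis
    define c where "c = Max (range r)"
    have c: "r i \<le> c" for i unfolding c_def by simp
    have "c \<in> range r" unfolding c_def by (rule Max_in) auto
    then have c1: "0 \<le> c" "c < 1" using r(1,2) by (auto intro: less_imp_le)
    have "dist (f x) (f y) \<le> c * dist x y" if "x \<in> unit_cube" "y \<in> unit_cube" for x y
    proof (rule dist_le_componentwise_cart[OF _ c1(1)])
      fix i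
      show "\<bar>f x $ i - f y $ i\<bar> \<le> c * \<bar>x $ i - y $ i\<bar>"
        using r(3)[of "x $ i" "y $ i" i] that mult_right_mono[OF c[of i], of "\<bar>x $ i - y $ i\<bar>"]
        by (simp add: a(2) slicing_map_def mem_unit_cube dist_real_def)
    qed
    then show ?thesis using c1(2) by blast
  qed
qed (use unit_cube_ne in auto)

lemma sierpinski_map_component:
  assumes "\<And>i. 0 < n i"
  shows "sierpinski_map (diag_matrix n) a z $ i = (z $ i + real (a $ i)) / real (n i)"
proof -
  define N :: "real^'a^'a" where "N = (\<chi> i j. if i = j then 1 / real (n i) else 0)"
  have n0: "real (n i) \<noteq> 0" for i using assms[of i] by simp
  have inv: "diag_matrix n ** N = mat 1" "N ** diag_matrix n = mat 1"
    using n0 by (simp_all add: matrix_matrix_mult_def diag_matrix_def N_def mat_def vec_eq_iff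
        if_distrib[of "\<lambda>x. x * y" for y] cong: if_cong)
  then have "matrix_inv (diag_matrix n) ** diag_matrix n = mat 1"
    using someI[of "\<lambda>B. diag_matrix n ** B = mat 1 \<and> B ** diag_matrix n = mat 1" N]
    unfolding matrix_inv_def by simp
  then have "matrix_inv (diag_matrix n) = N"
    using inv(1) matrix_mul_assoc[of "matrix_inv (diag_matrix n)" "diag_matrix n" N]
    by (simp add: matrix_mul_lid matrix_mul_rid)
  then show ?thesis
    by (simp add: sierpinski_map_def N_def matrix_vector_mult_def
        if_distrib[of "\<lambda>x. x * y" for y] cong: if_cong)
qed

lemma is_attractor_sierpinski_sponge:
  assumes "slicing_ifs n \<phi> D"
  shows "is_attractor UNIV (sierpinski_map (diag_matrix n) ` D) (sierpinski_sponge (diag_matrix n) D)"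
  unfolding sierpinski_sponge_def
proof (rule is_attractor_attractor)
  have n2: "2 \<le> n i" for i using assms by (auto simp: slicing_ifs_def slicing_system_def)
  then have n0: "0 < n i" for i by (metis gr0I not_numeral_le_zero)
  note comp = sierpinski_map_component[OF n0]
  show "finite (sierpinski_map (diag_matrix n) ` D)" "sierpinski_map (diag_matrix n) ` D \<noteq> {}"
    using finite_digits[OF assms] assms by (auto simp: slicing_ifs_def)
  show "f ` unit_cube \<subseteq> unit_cube" if f: "f \<in> sierpinski_map (diag_matrix n) ` D" for f
  proof -
    obtain a where a: "a \<in> D" "f = sierpinski_map (diag_matrix n) a" using f by blast
    have "real (a $ i) + 1 \<le> real (n i)" for i
      using assms a(1) by (auto simp: slicing_ifs_def Suc_le_eq[symmetric] subset_iff)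
        (metis Suc_leI of_nat_Suc of_nat_le_iff add.commute)
    then have "0 \<le> f x $ i \<and> f x $ i \<le> 1" if "x \<in> unit_cube" for x i
      using that n0[of i] by (auto simp: a(2) comp mem_unit_cube divide_le_eq_1)
        (smt (verit, best))+
    then show ?thesis by (auto simp: mem_unit_cube)
  qed
  show "\<exists>c<1. \<forall>x\<in>UNIV. \<forall>y\<in>UNIV. dist (f x) (f y) \<le> c * dist x y"
    if f: "f \<in> sierpinski_map (diag_matrix n) ` D" for f
  proof -
    obtain a where a: "a \<in> D" "f = sierpinski_map (diag_matrix n) a" using f by blast
    have "dist (f x) (f y) \<le> 1 / 2 * dist x y" for x y
    proof (rule dist_le_componentwise_cart)
      fix i
      have "f x $ i - f y $ i = (x $ i - y $ i) / real (n i)"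
        by (simp add: a(2) comp diff_divide_distrib[symmetric])
      moreover have "\<bar>x $ i - y $ i\<bar> / real (n i) \<le> \<bar>x $ i - y $ i\<bar> / 2"
        using n2[of i] by (intro divide_left_mono) auto
      ultimately show "\<bar>f x $ i - f y $ i\<bar> \<le> 1 / 2 * \<bar>x $ i - y $ i\<bar>"
        by simp
    qed simp
    then show ?thesis by (intro exI[of _ "1/2"]) simp
  qed
qed (use unit_cube_ne in auto)

end

theory Submission
  imports Defs
begin

text \<open>
  Both sponges are coded by sequences of digits in \<^term>\<open>D\<close>, and the bijection matches points with
  the same code. Instead of coding maps, the proof uses the graph of the bijection, which is itself
  an attractor: let \<open>G\<close> be the attractor in the product of two unit cubes of the pairs of maps with
  equal digit. Both projections of \<open>G\<close> are invariant compact sets, so uniqueness of attractors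
  identifies them with the two sponges (lemma \<open>attractor_coupling\<close>). It remains to see that
  \<open>G\<close> is bi-Hoelder: then it is the graph of a bijection.

  The Hoelder bounds are one-dimensional. In each coordinate a slicing system consists of the
  increasing affine maps of \<open>[0,1]\<close> onto consecutive cells of a partition
  (\<open>slicing_system_cut_points\<close>), and the coordinate of a Sierpinski map is the same with
  equal cells. A pair \<open>(x, u)\<close> of corresponding coordinates of a point of \<open>G\<close> lies in cells of equal
  index, and rescaling both cells gives again such a pair; the set of these pairs is
  called \<open>self_coded\<close>. Choose \<open>\<alpha>\<close> so small that every cell length is at most the
  \<open>\<alpha>\<close>-th power of the corresponding cell length of the other system. Then rescaling a common cell never spoils an
  estimate \<open>\<bar>u - v\<bar> \<le> C * \<bar>x - y\<bar> powr \<alpha>\<close>, and one may zoom in until \<open>x\<close> and \<open>y\<close> lie in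
  different cells. If the cells are not adjacent, then \<open>\<bar>x - y\<bar>\<close> is bounded below. If they are
  adjacent, both points are compared with the common endpoint, and zooming in at
  an endpoint of \<open>[0,1]\<close> gives that comparison in the same manner. This yields
  \<open>self_coded_holder\<close>, which applies in both directions as the roles of the two systems are
  symmetric.

  The boundary condition is a consequence of the same bound: the pairs \<open>(0, 0)\<close> and \<open>(1, 1)\<close>
  can be added to the coordinate pairs, so \<open>x = 0\<close> forces \<open>u = 0\<close> and \<open>x = 1\<close> forces \<open>u = 1\<close>.
\<close>

section \<open>Partitions of the unit interval into cells\<close>

definition cut_points :: "nat \<Rightarrow> (nat \<Rightarrow> real) \<Rightarrow> bool" where
  "cut_points m c \<longleftrightarrow> 2 \<le> m \<and> c 0 = 0 \<and> c m = 1 \<and> (\<forall>a<m. c a < c (Suc a))"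

abbreviation gap :: "(nat \<Rightarrow> real) \<Rightarrow> nat \<Rightarrow> real" where
  "gap c a \<equiv> c (Suc a) - c a"

definition cell_map :: "(nat \<Rightarrow> real) \<Rightarrow> nat \<Rightarrow> real \<Rightarrow> real" where
  "cell_map c a x = c a + gap c a * x"

lemma cut_points_mono:
  assumes "cut_points m c" "a \<le> b" "b \<le> m"
  shows "c a \<le> c b"
  using assms(2,3)
proof (induction b rule: dec_induct)
  case (step b)
  have "c b < c (Suc b)" using assms(1) step by (simp add: cut_points_def)
  then show ?case using step by simp
qed simp

lemma cut_points_gap:
  assumes "cut_points m c" "a < m"
  shows "0 < gap c a" "gap c a < 1"
proof -
  have *: "2 \<le> m" "c 0 = 0" "c m = 1" "\<And>b. b < m \<Longrightarrow> c b < c (Suc b)"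
    using assms(1) by (auto simp: cut_points_def)
  show "0 < gap c a" using *(4) assms(2) by simp
  show "gap c a < 1"
  proof (cases "a = 0")
    case True
    then have "c 1 < c 2" using *(1) *(4)[of 1] by (simp add: numeral_2_eq_2)
    then show ?thesis using True cut_points_mono[OF assms(1), of 2 m] * by simp
  next
    case False
    then have "c 0 < c 1" "c 1 \<le> c a" "c (Suc a) \<le> c m"
      using *(4)[of 0] assms(2) cut_points_mono[OF assms(1), of 1 a]
        cut_points_mono[OF assms(1), of "Suc a" m] by simp_all
    then show ?thesis using * by simp
  qed
qed

lemma cell_map_bounds:
  assumes "cut_points m c" "a < m" "x \<in> {0..1}"
  shows "c a \<le> cell_map c a x" "cell_map c a x \<le> c (Suc a)"
proof -
  have "0 \<le> gap c a * x" "gap c a * x \<le> gap c a * 1"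
    using cut_points_gap(1)[OF assms(1,2)] assms(3) by (auto intro: mult_left_mono)
  then show "c a \<le> cell_map c a x" "cell_map c a x \<le> c (Suc a)"
    by (auto simp: cell_map_def)
qed

lemma cell_map_unit_interval:
  assumes "cut_points m c" "a < m" "x \<in> {0..1}"
  shows "cell_map c a x \<in> {0..1}"
  using cell_map_bounds[OF assms] cut_points_mono[OF assms(1), of 0 a]
    cut_points_mono[OF assms(1), of "Suc a" m] assms(1,2) by (simp add: cut_points_def)

lemma cell_map_diff: "cell_map c a x - cell_map c a y = gap c a * (x - y)"
  by (simp add: cell_map_def algebra_simps)

lemma cell_map_endpoints: "cell_map c a 0 = c a" "cell_map c a 1 = c (Suc a)"
  by (simp_all add: cell_map_def)

lemma gaps_bounded:
  assumes "cut_points m c"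
  obtains \<delta> \<theta> where "0 < \<delta>" "\<theta> < 1" "\<And>a. a < m \<Longrightarrow> \<delta> \<le> gap c a" "\<And>a. a < m \<Longrightarrow> gap c a \<le> \<theta>"
proof -
  have fin: "finite (gap c ` {..<m})" "gap c ` {..<m} \<noteq> {}"
    using assms by (auto simp: cut_points_def lessThan_empty_iff)
  show ?thesis
    by (rule that[of "Min (gap c ` {..<m})" "Max (gap c ` {..<m})"])
      (use fin cut_points_gap[OF assms] in auto)
qed

section \<open>Slicing systems are given by their cut points\<close>

text \<open>
  The distances of \<open>f x\<close> from \<open>f 0\<close> and from \<open>f 1\<close> add up to the distance of \<open>f 0\<close> and \<open>f 1\<close>, so
  \<open>f x\<close> lies between them, at the proportion given by \<open>x\<close>.
\<close>

lemma contracting_similarity_affine: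
  assumes "contracting_similarity_on {0..1} (f :: real \<Rightarrow> real)"
  obtains r where "r \<noteq> 0" "\<And>x. x \<in> {0..1} \<Longrightarrow> f x = f 0 + r * x"
proof -
  obtain r where r: "0 < r" "\<And>x y. x \<in> {0..1} \<Longrightarrow> y \<in> {0..1} \<Longrightarrow> \<bar>f x - f y\<bar> = r * \<bar>x - y\<bar>"
    using assms unfolding contracting_similarity_on_def dist_real_def by blast
  have one: "\<bar>f 1 - f 0\<bar> = r" using r(2)[of 1 0] by simp
  have "f x = f 0 + (f 1 - f 0) * x" if "x \<in> {0..1}" for x
  proof -
    have "\<bar>f x - f 0\<bar> = r * x" "\<bar>f 1 - f x\<bar> = r * (1 - x)"
      using r(2)[of x 0] r(2)[of 1 x] that by auto
    moreover have "r * (1 - x) = r - r * x" by (simp add: right_diff_distrib)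
    ultimately consider "f 1 - f 0 = r" "f x - f 0 = r * x" | "f 1 - f 0 = - r" "f x - f 0 = - (r * x)"
      using one r(1) by linarith
    then show ?thesis by cases auto
  qed
  moreover have "f 1 - f 0 \<noteq> 0" using one r(1) by auto
  ultimately show ?thesis by (intro that)
qed

text \<open>
  The images of the half-open interval must themselves be closed on the left. A decreasing piece
  \<open>a\<close> would be open on the left, and its missing left endpoint \<open>f a 1\<close> would be the
  largest element of an earlier piece, which is impossible if all earlier pieces are increasing. Once
  all pieces increase, a gap between consecutive pieces would contain a point that no piece covers,
  so the pieces abut and their left endpoints are the cut points.
\<close>

lemma slicing_system_cut_points:
  assumes "slicing_system m f"
  obtains c where "cut_points m c" "\<And>a x. a < m \<Longrightarrow> x \<in> {0..1} \<Longrightarrow> f a x = cell_map c a x"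
proof -
  have m: "2 \<le> m" and sim_all: "\<forall>a<m. contracting_similarity_on {0..1} (f a)"
    and un: "(\<Union>a<m. f a ` {0..<1}) = {0..<1}"
    and ord_all: "\<forall>a<m. \<forall>b<m. a < b \<longrightarrow> (\<forall>x\<in>f a ` {0..<1}. \<forall>y\<in>f b ` {0..<1}. x < y)"
    using assms by (simp_all add: slicing_system_def)
  have sim: "contracting_similarity_on {0..1} (f a)" if "a < m" for a
    using sim_all that by simp
  have ord: "f a s < f b t" if "a < b" "b < m" "s \<in> {0..<1}" "t \<in> {0..<1}" for a b s t
    using ord_all[rule_format, OF less_trans[OF that(1,2)] that(2,1) imageI[OF that(3)] imageI[OF that(4)]] .
  have "\<exists>r. r \<noteq> 0 \<and> (\<forall>x\<in>{0..1}. f a x = f a 0 + r * x)" if "a < m" for a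
    by (rule contracting_similarity_affine[OF sim[OF that]]) blast
  then have "\<exists>r. \<forall>a<m. r a \<noteq> 0 \<and> (\<forall>x\<in>{0..1}. f a x = f a 0 + r a * x)"
    by (intro choice) simp
  then obtain r where r0: "\<And>a. a < m \<Longrightarrow> r a \<noteq> 0"
    and r: "\<And>a x. a < m \<Longrightarrow> x \<in> {0..1} \<Longrightarrow> f a x = f a 0 + r a * x"
    by blast
  have self: "f a x \<in> {0..1}" if "a < m" "x \<in> {0..1}" for a x
    using sim[OF that(1)] that(2) by (auto simp only: contracting_similarity_on_def)
  have lt1: "f a x < 1" if "a < m" "x \<in> {0..<1}" for a x
  proof -
    have "f a x \<in> (\<Union>a<m. f a ` {0..<1})" using that by blast
    then show ?thesis unfolding un by simp
  qed
  have cover: "\<exists>b<m. \<exists>t\<in>{0..<1}. x = f b t" if "x \<in> {0..<1}" for x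
  proof -
    have "x \<in> (\<Union>a<m. f a ` {0..<1})" using that un by simp
    then show ?thesis by blast
  qed
  have lim: "f a 1 \<le> y" if a: "a < m" and le: "\<And>s. s \<in> {0..<1} \<Longrightarrow> f a s \<le> y" for a y
  proof -
    have "r a \<le> y - f a 0"
    proof (rule field_le_mult_one_interval)
      fix s :: real assume "0 < s" "s < 1"
      then show "s * r a \<le> y - f a 0"
        using le[of s] r[OF a, of s] by (simp add: mult.commute)
    qed
    then show ?thesis using r[OF a, of 1] by simp
  qed
  have lim': "y \<le> f a 1" if a: "a < m" and le: "\<And>s. s \<in> {0..<1} \<Longrightarrow> y \<le> f a s" for a y
  proof -
    have "- r a \<le> f a 0 - y"
    proof (rule field_le_mult_one_interval)
      fix s :: real assume "0 < s" "s < 1"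
      then show "s * - r a \<le> f a 0 - y"
        using le[of s] r[OF a, of s] by (simp add: mult.commute)
    qed
    then show ?thesis using r[OF a, of 1] by simp
  qed
  have pos: "0 < r a" if "a < m" for a
    using that
  proof (induction a rule: less_induct)
    case (less a)
    show ?case
    proof (rule ccontr)
      assume "\<not> 0 < r a"
      then have neg: "r a < 0" using r0 less.prems by force
      have f1: "f a 1 = f a 0 + r a" using r[OF less.prems, of 1] by simp
      then have "f a 1 \<in> {0..<1}"
        using self[OF less.prems, of 1] neg lt1[OF less.prems, of 0] by simp
      then obtain b t where b: "b < m" "t \<in> {0..<1}" "f a 1 = f b t" using cover by blast
      \<comment> \<open>The point \<open>f b t\<close> is the maximum of the earlier piece \<open>b\<close>, but \<open>f b\<close> increases and \<open>t < 1\<close>.\<close>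
      have above: "f b t < f a s" if "s \<in> {0..<1}" for s
        using r[OF less.prems, of s] f1 b(3) that mult_less_cancel_left_neg[OF neg, of 1 s] by simp
      have "b \<noteq> a" using above[of t] b(2) by auto
      moreover have "\<not> a < b" using ord[of a b 0 t] above[of 0] b by force
      ultimately have ba: "b < a" by simp
      then have rb: "0 < r b" using less.IH b(1) by blast
      have "f b ((1 + t) / 2) \<le> f a 1"
        using lim'[OF less.prems, of "f b ((1 + t) / 2)"] ord[OF ba less.prems, of "(1 + t) / 2"] b(2)
        by (auto intro: less_imp_le)
      moreover have "f b t < f b ((1 + t) / 2)"
        using r[OF b(1), of t] r[OF b(1), of "(1 + t) / 2"] b(2) rb by simp
      ultimately show False using b(3) by simp
    qed
  qed
  have lower: "f a 0 \<le> f a x" "f a x \<le> f a 1" if "a < m" "x \<in> {0..1}" for a x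
    using r[OF that] r[OF that(1), of 1] pos[OF that(1)] that(2) by (simp_all add: mult_left_le)
  have below1: "f a x < f a 1" if "a < m" "x \<in> {0..<1}" for a x
    using r[OF that(1), of x] r[OF that(1), of 1] pos[OF that(1)] that(2) by simp
  define c where "c = (\<lambda>a. if a < m then f a 0 else 1)"
  have next_cut: "f a 1 = c (Suc a)" if a: "a < m" for a
  proof (rule antisym)
    show le: "f a 1 \<le> c (Suc a)"
      using lim[OF a, of "f (Suc a) 0"] ord[of a "Suc a" _ 0] self[OF a, of 1]
      by (auto simp: c_def intro: less_imp_le)
    show "c (Suc a) \<le> f a 1"
    proof (rule ccontr)
      assume n: "\<not> c (Suc a) \<le> f a 1"
      have "c (Suc a) \<le> 1" using self[of "Suc a" 0] by (auto simp: c_def)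
      then have "f a 1 \<in> {0..<1}" using n self[OF a, of 1] by auto
      then obtain b t where b: "b < m" "t \<in> {0..<1}" "f a 1 = f b t" using cover by blast
      consider "b < a" | "b = a" | "b = Suc a" | "Suc a < b" by linarith
      then show False
      proof cases
        case 1
        then show ?thesis using ord[OF 1 a b(2), of 0] lower(1)[OF a, of 1] b by simp
      next
        case 2
        then show ?thesis using below1[OF a b(2)] b by simp
      next
        case 3
        then show ?thesis using lower(1)[OF b(1), of t] b n by (simp add: c_def)
      next
        case 4
        then show ?thesis using ord[OF 4 b(1), of 0 t] b n by (simp add: c_def)
      qed
    qed
  qed
  have "c 0 = 0"
  proof -
    obtain b t where b: "b < m" "t \<in> {0..<1}" "0 = f b t" using cover[of 0] by auto
    have "b = 0" using ord[of 0 b 0 t] b self[of 0 0] m by force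
    then show ?thesis
      using lower(1)[OF b(1), of t] self[OF b(1), of 0] b m by (simp add: c_def)
  qed
  moreover have "c a < c (Suc a)" if "a < m" for a
    using next_cut[OF that] below1[OF that, of 0] that by (simp add: c_def)
  ultimately have "cut_points m c" using m by (simp add: cut_points_def c_def)
  moreover have "f a x = cell_map c a x" if "a < m" "x \<in> {0..1}" for a x
    using r[OF that] r[OF that(1), of 1] next_cut[OF that(1)] that(1)
    by (simp add: cell_map_def c_def)
  ultimately show ?thesis by (rule that)
qed

section \<open>Corresponding points of two partitions\<close>

text \<open>
  The condition is an inclusion because some letter may occur in no digit: the coordinate pairs of a
  graph point are then images under the letters that do occur, while the images under the
  other letters need not be coordinate pairs again.
\<close>

definition self_coded :: "nat \<Rightarrow> (nat \<Rightarrow> real) \<Rightarrow> (nat \<Rightarrow> real) \<Rightarrow> (real \<times> real) set \<Rightarrow> bool" where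
  "self_coded m c c' E \<longleftrightarrow> E \<subseteq> {0..1} \<times> {0..1} \<and>
     (\<forall>(x, u)\<in>E. \<exists>a<m. \<exists>(y, v)\<in>E. x = cell_map c a y \<and> u = cell_map c' a v)"

lemma self_codedE:
  assumes "self_coded m c c' E" "(x, u) \<in> E"
  obtains a y v where "a < m" "(y, v) \<in> E" "x = cell_map c a y" "u = cell_map c' a v"
proof -
  have "\<exists>a<m. \<exists>(y, v)\<in>E. x = cell_map c a y \<and> u = cell_map c' a v"
    using bspec[OF conjunct2[OF assms(1)[unfolded self_coded_def]] assms(2)] by simp
  then show ?thesis using that by auto
qed

lemma self_coded_converse:
  assumes "self_coded m c c' E"
  shows "self_coded m c' c (E\<inverse>)"
  unfolding self_coded_def
proof (intro conjI ballI)
  show "E\<inverse> \<subseteq> {0..1} \<times> {0..1}" using assms by (auto simp: self_coded_def)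
  fix p assume "p \<in> E\<inverse>"
  then obtain x u where p: "p = (u, x)" "(x, u) \<in> E" by auto
  obtain a y v where "a < m" "(y, v) \<in> E" "x = cell_map c a y" "u = cell_map c' a v"
    using self_codedE[OF assms p(2)] .
  then show "case p of (x, u) \<Rightarrow> \<exists>a<m. \<exists>(y, v)\<in>E\<inverse>. x = cell_map c' a y \<and> u = cell_map c a v"
    by (auto simp: p(1) intro!: exI[of _ a] bexI[of _ "(v, y)"])
qed

text \<open>
  The principle behind zooming in: if an estimate either holds or follows from the same estimate at
  another point by a factor bounded away from 1, it always holds, as the error that is left after
  \<open>k\<close> steps is at most \<open>\<theta> ^ k\<close>.
\<close>

lemma bound_by_descent:
  fixes f g :: "'a \<Rightarrow> real"
  assumes \<theta>: "\<theta> < 1" and f: "\<And>s. s \<in> S \<Longrightarrow> f s \<le> 1" and g: "\<And>s. s \<in> S \<Longrightarrow> 0 \<le> g s"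
    and step: "\<And>s. s \<in> S \<Longrightarrow>
      f s \<le> g s \<or> (\<exists>t\<in>S. \<exists>l. 0 \<le> l \<and> l \<le> \<theta> \<and> f s \<le> l * f t \<and> l * g t \<le> g s)"
    and s: "s \<in> S"
  shows "f s \<le> g s"
proof (cases "0 \<le> \<theta>")
  case True
  have bound: "f s \<le> g s + \<theta> ^ k" if "s \<in> S" for s k
    using that
  proof (induction k arbitrary: s)
    case 0
    then show ?case using f g by fastforce
  next
    case (Suc k)
    show ?case
    proof (cases "f s \<le> g s")
      case True
      then show ?thesis using \<open>0 \<le> \<theta>\<close> by (simp add: add_increasing2)
    next
      case False
      then obtain t l where t: "t \<in> S" "0 \<le> l" "l \<le> \<theta>" "f s \<le> l * f t" "l * g t \<le> g s"
        using step Suc.prems by blast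
      have "l * f t \<le> l * (g t + \<theta> ^ k)" using Suc.IH[OF t(1)] t(2) by (rule mult_left_mono)
      moreover have "l * \<theta> ^ k \<le> \<theta> * \<theta> ^ k" using t(3) True by (intro mult_right_mono) auto
      ultimately show ?thesis using t(4,5) by (simp add: algebra_simps)
    qed
  qed
  have "(\<lambda>k. g s + \<theta> ^ k) \<longlonglongrightarrow> g s + 0"
    by (intro tendsto_intros LIMSEQ_power_zero) (use \<theta> True in simp)
  then show ?thesis
    using bound[OF s] by (intro LIMSEQ_le_const[of _ "g s"]) auto
next
  case False
  then show ?thesis using step[OF s] by force
qed

text \<open>Rescaling by a pair of corresponding cell lengths preserves Hoelder estimates.\<close>

lemma powr_rescale:
  fixes l l' :: real
  assumes "0 < l" "l' \<le> l powr \<alpha>" "0 < \<delta>" "0 \<le> t"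
  shows "l' * (t / \<delta>) powr \<alpha> \<le> (l * t / \<delta>) powr \<alpha>"
proof -
  have "(l * t / \<delta>) powr \<alpha> = l powr \<alpha> * (t / \<delta>) powr \<alpha>"
    using assms powr_mult[of l "t / \<delta>" \<alpha>] by simp
  then show ?thesis using assms(2) by (simp add: mult_right_mono)
qed

text \<open>
  Here \<open>(p, q)\<close> is meant to be one of the corner pairs \<open>(0, 0)\<close> and \<open>(1, 1)\<close>, and \<open>e\<close> the first or
  the last cell, whose maps fix it. Points outside the cell \<open>e\<close> are at distance at least \<open>\<delta>\<close> from
  \<open>p\<close>; for points inside, one zooms into the cell.
\<close>

lemma self_coded_endpoint_holder:
  assumes c: "cut_points m c" and c': "cut_points m c'" and E: "self_coded m c c' E"
    and \<alpha>: "0 < \<alpha>" and scale: "\<And>a. a < m \<Longrightarrow> gap c' a \<le> gap c a powr \<alpha>"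
    and \<delta>: "0 < \<delta>"
    and fixed: "e < m" "cell_map c e p = p" "cell_map c' e q = q" and q: "q \<in> {0..1}"
    and far: "\<And>b x. b < m \<Longrightarrow> b \<noteq> e \<Longrightarrow> x \<in> {0..1} \<Longrightarrow> \<delta> \<le> \<bar>cell_map c b x - p\<bar>"
    and xu: "(x, u) \<in> E"
  shows "\<bar>u - q\<bar> \<le> (\<bar>x - p\<bar> / \<delta>) powr \<alpha>"
proof -
  obtain \<theta> where \<theta>: "\<theta> < 1" "\<And>a. a < m \<Longrightarrow> gap c' a \<le> \<theta>" using gaps_bounded[OF c'] by metis
  have Eu: "y \<in> {0..1}" "v \<in> {0..1}" if "(y, v) \<in> E" for y v
    using E that unfolding self_coded_def by auto
  let ?f = "\<lambda>s. \<bar>snd s - q\<bar>" and ?g = "\<lambda>s. (\<bar>fst s - p\<bar> / \<delta>) powr \<alpha>"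
  have "?f (x, u) \<le> ?g (x, u)"
  proof (rule bound_by_descent[where S = E and f = ?f and g = ?g and \<theta> = \<theta>])
    fix s assume s: "s \<in> E"
    show "?f s \<le> 1" using Eu[of "fst s" "snd s"] s q by (auto simp: abs_le_iff)
    obtain a y v where a: "a < m" "(y, v) \<in> E" "s = (cell_map c a y, cell_map c' a v)"
      using self_codedE[OF E, of "fst s" "snd s"] s by (metis prod.collapse)
    show "?f s \<le> ?g s \<or> (\<exists>t\<in>E. \<exists>l. 0 \<le> l \<and> l \<le> \<theta> \<and> ?f s \<le> l * ?f t \<and> l * ?g t \<le> ?g s)"
    proof (cases "a = e")
      case True
      note g = cut_points_gap(1)[OF c a(1)] and g' = cut_points_gap(1)[OF c' a(1)]
      have "?f s = gap c' a * \<bar>v - q\<bar>" "\<bar>fst s - p\<bar> = gap c a * \<bar>y - p\<bar>"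
        using cell_map_diff[of c' a v q] cell_map_diff[of c a y p] fixed True a(3) g g'
        by (simp_all add: abs_mult)
      then show ?thesis
        using powr_rescale[OF g scale[OF a(1)] \<delta>, of "\<bar>y - p\<bar>"] \<theta>(2)[OF a(1)] a(2) g'
        by (intro disjI2 bexI[of _ "(y, v)"] exI[of _ "gap c' a"]) auto
    next
      case False
      then have "1 \<le> \<bar>fst s - p\<bar> / \<delta>" using far[OF a(1) False Eu(1)[OF a(2)]] \<delta> a(3) by simp
      then have "1 \<le> ?g s" using \<alpha> by (intro ge_one_powr_ge_zero) auto
      then show ?thesis using \<open>?f s \<le> 1\<close> by linarith
    qed
  qed (use \<theta>(1) xu in auto)
  then show ?thesis by simp
qed

text \<open>
  Zooming into common cells reduces the estimate to points in different cells, at no cost in the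
  constant. The factor 2 arises from passing through the common endpoint of
  adjacent cells.
\<close>

lemma self_coded_holder:
  assumes c: "cut_points m c" and c': "cut_points m c'" and E: "self_coded m c c' E"
    and \<alpha>: "0 < \<alpha>" and scale: "\<And>a. a < m \<Longrightarrow> gap c' a \<le> gap c a powr \<alpha>"
  obtains C where "0 \<le> C"
    "\<And>x u y v. (x, u) \<in> E \<Longrightarrow> (y, v) \<in> E \<Longrightarrow> \<bar>u - v\<bar> \<le> C * \<bar>x - y\<bar> powr \<alpha>"
proof -
  obtain \<theta> where \<theta>: "\<theta> < 1" "\<And>a. a < m \<Longrightarrow> gap c' a \<le> \<theta>" using gaps_bounded[OF c'] by metis
  obtain \<delta> where \<delta>: "0 < \<delta>" "\<And>a. a < m \<Longrightarrow> \<delta> \<le> gap c a" using gaps_bounded[OF c] by metis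
  have Eu: "x \<in> {0..1}" "u \<in> {0..1}" if "(x, u) \<in> E" for x u
    using E that unfolding self_coded_def by auto
  have m: "2 \<le> m" "c 0 = 0" "c m = 1" "c' 0 = 0" "c' m = 1"
    using c c' by (auto simp: cut_points_def)
  have zero: "\<bar>u\<bar> \<le> (\<bar>x\<bar> / \<delta>) powr \<alpha>" if xu: "(x, u) \<in> E" for x u
  proof -
    have "\<delta> \<le> \<bar>cell_map c b t - 0\<bar>" if "b < m" "b \<noteq> 0" "t \<in> {0..1}" for b t
      using \<delta>(2)[of 0] cut_points_mono[OF c, of 1 b] cell_map_bounds(1)[OF c that(1,3)] that m by simp
    then show ?thesis
      using self_coded_endpoint_holder[OF c c' E \<alpha> scale \<delta>(1), of 0 0 0 x u] m xu
      by (simp add: cell_map_endpoints)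
  qed
  have one: "\<bar>u - 1\<bar> \<le> (\<bar>x - 1\<bar> / \<delta>) powr \<alpha>" if xu: "(x, u) \<in> E" for x u
  proof -
    have "\<delta> \<le> \<bar>cell_map c b t - 1\<bar>" if "b < m" "b \<noteq> m - 1" "t \<in> {0..1}" for b t
    proof -
      have "Suc b \<le> m - 1" using that(1,2) by linarith
      then have "c (Suc b) \<le> c (m - 1)" using cut_points_mono[OF c] by simp
      then show ?thesis
        using \<delta>(2)[of "m - 1"] cell_map_bounds(2)[OF c that(1,3)] m by simp
    qed
    then show ?thesis
      using self_coded_endpoint_holder[OF c c' E \<alpha> scale \<delta>(1), of "m - 1" 1 1 x u] m xu
      by (simp add: cell_map_endpoints)
  qed
  have apart: "\<bar>cell_map c' a u - cell_map c' b v\<bar>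
      \<le> 2 * (\<bar>cell_map c a x - cell_map c b y\<bar> / \<delta>) powr \<alpha>"
    if ab: "a < b" "b < m" and xu: "(x, u) \<in> E" and yv: "(y, v) \<in> E" for a b x u y v
  proof -
    have a: "a < m" using ab by simp
    define t where "t = \<bar>cell_map c a x - cell_map c b y\<bar>"
    have mid: "c (Suc a) \<le> c b" using cut_points_mono[OF c, of "Suc a" b] ab by simp
    have t1: "c (Suc a) - cell_map c a x + (c b - c (Suc a)) + (cell_map c b y - c b) = t"
      using cell_map_bounds(2)[OF c a Eu(1)[OF xu]] cell_map_bounds(1)[OF c ab(2) Eu(1)[OF yv]] mid
      by (simp add: t_def)
    have nonneg: "0 \<le> c (Suc a) - cell_map c a x" "0 \<le> cell_map c b y - c b"
      using cell_map_bounds(2)[OF c a Eu(1)[OF xu]] cell_map_bounds(1)[OF c ab(2) Eu(1)[OF yv]] by auto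
    show ?thesis
    proof (cases "b = Suc a")
      case True
      have da: "c (Suc a) - cell_map c a x = gap c a * \<bar>x - 1\<bar>"
        and da': "c' (Suc a) - cell_map c' a u = gap c' a * \<bar>u - 1\<bar>"
        using Eu[OF xu] by (simp_all add: cell_map_def algebra_simps)
      have db: "cell_map c b y - c b = gap c b * \<bar>y\<bar>"
        and db': "cell_map c' b v - c' b = gap c' b * \<bar>v\<bar>"
        using Eu[OF yv] by (simp_all add: cell_map_def)
      have A: "c' (Suc a) - cell_map c' a u \<le> (t / \<delta>) powr \<alpha>"
      proof -
        have "gap c' a * \<bar>u - 1\<bar> \<le> gap c' a * (\<bar>x - 1\<bar> / \<delta>) powr \<alpha>"
          using one[OF xu] cut_points_gap(1)[OF c' a] by (intro mult_left_mono) auto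
        also have "\<dots> \<le> (gap c a * \<bar>x - 1\<bar> / \<delta>) powr \<alpha>"
          using powr_rescale[OF cut_points_gap(1)[OF c a] scale[OF a] \<delta>(1)] by simp
        also have "\<dots> \<le> (t / \<delta>) powr \<alpha>"
          using da nonneg t1 mid \<delta>(1) \<alpha> by (intro powr_mono2 divide_right_mono) auto
        finally show ?thesis using da' by simp
      qed
      have B: "cell_map c' b v - c' b \<le> (t / \<delta>) powr \<alpha>"
      proof -
        have "gap c' b * \<bar>v\<bar> \<le> gap c' b * (\<bar>y\<bar> / \<delta>) powr \<alpha>"
          using zero[OF yv] cut_points_gap(1)[OF c' ab(2)] by (intro mult_left_mono) auto
        also have "\<dots> \<le> (gap c b * \<bar>y\<bar> / \<delta>) powr \<alpha>"
          using powr_rescale[OF cut_points_gap(1)[OF c ab(2)] scale[OF ab(2)] \<delta>(1)] by simp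
        also have "\<dots> \<le> (t / \<delta>) powr \<alpha>"
          using db nonneg t1 mid \<delta>(1) \<alpha> by (intro powr_mono2 divide_right_mono) auto
        finally show ?thesis using db' by simp
      qed
      show ?thesis
        using A B True cell_map_bounds(2)[OF c' a Eu(2)[OF xu]]
          cell_map_bounds(1)[OF c' ab(2) Eu(2)[OF yv]]
        unfolding t_def[symmetric] by (simp add: abs_le_iff)
    next
      case False
      then have "\<delta> \<le> c b - c (Suc a)"
        using \<delta>(2)[of "Suc a"] cut_points_mono[OF c, of "Suc (Suc a)" b] ab by simp
      then have "1 \<le> t / \<delta>" using nonneg t1 \<delta>(1) by simp
      then have "1 \<le> (t / \<delta>) powr \<alpha>" using \<alpha> by (intro ge_one_powr_ge_zero) auto
      moreover have "cell_map c' a u \<in> {0..1}" "cell_map c' b v \<in> {0..1}"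
        using cell_map_unit_interval[OF c'] a ab Eu xu yv by blast+
      ultimately show ?thesis unfolding t_def[symmetric] by (simp add: abs_le_iff)
    qed
  qed
  let ?f = "\<lambda>((x :: real, u), (y :: real, v)). \<bar>u - v\<bar> :: real"
    and ?g = "\<lambda>((x, u :: real), (y, v :: real)). 2 * (\<bar>x - y\<bar> / \<delta>) powr \<alpha>"
  have main: "\<bar>u - v\<bar> \<le> 2 * (\<bar>x - y\<bar> / \<delta>) powr \<alpha>" if xu: "(x, u) \<in> E" and yv: "(y, v) \<in> E" for x u y v
  proof -
    have "?f ((x, u), (y, v)) \<le> ?g ((x, u), (y, v))"
    proof (rule bound_by_descent[where S = "E \<times> E" and f = ?f and g = ?g and \<theta> = \<theta>])
      fix s assume "s \<in> E \<times> E"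
      then obtain x u y v where s: "s = ((x, u), (y, v))" and xu: "(x, u) \<in> E" and yv: "(y, v) \<in> E"
        by (metis SigmaE prod.collapse)
      show "?f s \<le> 1" using Eu(2)[OF xu] Eu(2)[OF yv] by (auto simp: s abs_le_iff)
      show "0 \<le> ?g s" by (simp add: s)
      obtain a x1 u1 where a: "a < m" "(x1, u1) \<in> E" "x = cell_map c a x1" "u = cell_map c' a u1"
        using self_codedE[OF E xu] by blast
      obtain b y1 v1 where b: "b < m" "(y1, v1) \<in> E" "y = cell_map c b y1" "v = cell_map c' b v1"
        using self_codedE[OF E yv] by blast
      consider "a < b" | "b < a" | "a = b" by linarith
      then show "?f s \<le> ?g s \<or>
          (\<exists>t\<in>E \<times> E. \<exists>l. 0 \<le> l \<and> l \<le> \<theta> \<and> ?f s \<le> l * ?f t \<and> l * ?g t \<le> ?g s)"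
      proof cases
        case 1
        then show ?thesis using apart[OF 1 b(1) a(2) b(2)] by (simp add: s a b)
      next
        case 2
        then show ?thesis using apart[OF 2 a(1) b(2) a(2)] by (simp add: s a b abs_minus_commute)
      next
        case 3
        note g = cut_points_gap(1)[OF c a(1)] and g' = cut_points_gap(1)[OF c' a(1)]
        have "\<bar>u - v\<bar> = gap c' a * \<bar>u1 - v1\<bar>" "\<bar>x - y\<bar> = gap c a * \<bar>x1 - y1\<bar>"
          using cell_map_diff[of c' a u1 v1] cell_map_diff[of c a x1 y1] 3 a b g g'
          by (simp_all add: abs_mult)
        then show ?thesis
          using powr_rescale[OF g scale[OF a(1)] \<delta>(1), of "\<bar>x1 - y1\<bar>"] \<theta>(2)[OF a(1)] a(2) b(2) g'
          by (intro disjI2 bexI[of _ "((x1, u1), (y1, v1))"] exI[of _ "gap c' a"]) (auto simp: s)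
      qed
    qed (use \<theta>(1) xu yv in auto)
    then show ?thesis by simp
  qed
  show ?thesis
  proof (rule that[of "2 * (1 / \<delta>) powr \<alpha>"])
    fix x u y v assume "(x, u) \<in> E" "(y, v) \<in> E"
    moreover have "(\<bar>x - y\<bar> / \<delta>) powr \<alpha> = (1 / \<delta>) powr \<alpha> * \<bar>x - y\<bar> powr \<alpha>"
      using powr_mult[of "1 / \<delta>" "\<bar>x - y\<bar>" \<alpha>] \<delta>(1) by simp
    ultimately show "\<bar>u - v\<bar> \<le> 2 * (1 / \<delta>) powr \<alpha> * \<bar>x - y\<bar> powr \<alpha>"
      using main by (metis mult.assoc)
  qed simp
qed

section \<open>Products of cell maps\<close>

lemma cell_product_contraction:
  fixes T :: "real^'d \<Rightarrow> real^'d::finite"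
  assumes c: "\<And>i. cut_points (n i) (c i)" and a: "\<And>i. a $ i < n i"
    and T: "\<And>x i. x \<in> X \<Longrightarrow> T x $ i = cell_map (c i) (a $ i) (x $ i)"
  shows "\<exists>k<1. \<forall>x\<in>X. \<forall>y\<in>X. dist (T x) (T y) \<le> k * dist x y"
proof -
  define k where "k = Max (range (\<lambda>i. gap (c i) (a $ i)))"
  note g = cut_points_gap[OF c a]
  have "k \<in> range (\<lambda>i. gap (c i) (a $ i))" unfolding k_def by (rule Max_in) auto
  then have k: "0 \<le> k" "k < 1" using g by (auto intro: less_imp_le)
  have le: "gap (c i) (a $ i) \<le> k" for i unfolding k_def by simp
  have "dist (T x) (T y) \<le> k * dist x y" if x: "x \<in> X" and y: "y \<in> X" for x y
  proof (rule dist_le_componentwise_cart[OF _ k(1)])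
    fix i
    have "\<bar>T x $ i - T y $ i\<bar> = gap (c i) (a $ i) * \<bar>x $ i - y $ i\<bar>"
      using g(1)[of i] by (simp add: T[OF x] T[OF y] cell_map_diff abs_mult)
    then show "\<bar>T x $ i - T y $ i\<bar> \<le> k * \<bar>x $ i - y $ i\<bar>"
      using mult_right_mono[OF le, of "\<bar>x $ i - y $ i\<bar>"] by simp
  qed
  then show ?thesis using k(2) by blast
qed

lemma cell_product_unit_cube:
  fixes T :: "real^'d \<Rightarrow> real^'d::finite"
  assumes c: "\<And>i. cut_points (n i) (c i)" and a: "\<And>i. a $ i < n i"
    and T: "\<And>x i. x \<in> unit_cube \<Longrightarrow> T x $ i = cell_map (c i) (a $ i) (x $ i)"
  shows "T ` unit_cube \<subseteq> unit_cube"
proof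
  fix y assume "y \<in> T ` unit_cube"
  then obtain x where x: "x \<in> unit_cube" "y = T x" by blast
  have "cell_map (c i) (a $ i) (x $ i) \<in> {0..1}" for i
    using x(1) by (intro cell_map_unit_interval[OF c a]) (simp add: mem_unit_cube)
  then show "y \<in> unit_cube" using T[OF x(1)] by (simp add: x(2) mem_unit_cube)
qed

section \<open>The graph as an attractor\<close>

text \<open>
  The projections of the attractor of the paired maps are compact and invariant under the maps of
  the respective factor, hence equal to the given attractors. The sets \<open>Y\<close> and \<open>Y'\<close> provide the
  compact set from which the paired attractor is obtained, and they also bound it: this is how
  the Sierpinski sponge, an attractor in the whole space, is seen to lie in the cube.
\<close>

lemma attractor_coupling:
  fixes S :: "'i \<Rightarrow> 'a::heine_borel \<Rightarrow> 'a" and T :: "'i \<Rightarrow> 'b::heine_borel \<Rightarrow> 'b"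
  assumes D: "finite D"
    and L: "is_attractor X (S ` D) L" and K: "is_attractor X' (T ` D) K"
    and S: "\<And>a. a \<in> D \<Longrightarrow> \<exists>k<1. \<forall>x\<in>X. \<forall>y\<in>X. dist (S a x) (S a y) \<le> k * dist x y"
    and T: "\<And>a. a \<in> D \<Longrightarrow> \<exists>k<1. \<forall>x\<in>X'. \<forall>y\<in>X'. dist (T a x) (T a y) \<le> k * dist x y"
    and Y: "compact Y" "Y \<noteq> {}" "Y \<subseteq> X" "\<And>a. a \<in> D \<Longrightarrow> S a ` Y \<subseteq> Y"
    and Y': "compact Y'" "Y' \<noteq> {}" "Y' \<subseteq> X'" "\<And>a. a \<in> D \<Longrightarrow> T a ` Y' \<subseteq> Y'"
  obtains G where "G \<subseteq> Y \<times> Y'" "fst ` G = L" "snd ` G = K"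
    "\<And>x u. (x, u) \<in> G \<Longrightarrow> \<exists>a\<in>D. \<exists>(y, v)\<in>G. x = S a y \<and> u = T a v"
proof -
  have cont: "continuous_on Z f"
    if f: "\<exists>k<1. \<forall>x\<in>W. \<forall>y\<in>W. dist (f x) (f y) \<le> k * dist x y" and Z: "Z \<subseteq> W"
    for Z W and f :: "'c::metric_space \<Rightarrow> 'c"
  proof -
    obtain k where k: "k < 1" "\<forall>x\<in>W. \<forall>y\<in>W. dist (f x) (f y) \<le> k * dist x y" using f by blast
    have "dist (f x) (f y) \<le> 1 * dist x y" if "x \<in> Z" "y \<in> Z" for x y
    proof -
      have "dist (f x) (f y) \<le> k * dist x y" using k(2) that Z by blast
      also have "\<dots> \<le> 1 * dist x y" using k(1) by (intro mult_right_mono) auto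
      finally show ?thesis .
    qed
    then show ?thesis by (intro lipschitz_on_continuous_on[of 1]) (simp add: lipschitz_on_def)
  qed
  define P where "P = (\<lambda>a. map_prod (S a) (T a))"
  have "D \<noteq> {}" using L by (auto simp: is_attractor_def)
  have "\<exists>G. is_attractor (Y \<times> Y') (P ` D) G"
  proof (rule is_attractor_exists)
    show "finite (P ` D)" "P ` D \<noteq> {}" using D \<open>D \<noteq> {}\<close> by auto
    show "compact (Y \<times> Y')" "Y \<times> Y' \<noteq> {}" using Y Y' by (auto intro: compact_Times)
    show "continuous_on (Y \<times> Y') f" if "f \<in> P ` D" for f
    proof -
      obtain a where a: "a \<in> D" "f = P a" using \<open>f \<in> P ` D\<close> by blast
      have "continuous_on (Y \<times> Y') (\<lambda>p. S a (fst p))" "continuous_on (Y \<times> Y') (\<lambda>p. T a (snd p))"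
        by (rule continuous_on_compose2[OF cont[OF S[OF a(1)] Y(3)] continuous_on_fst[OF continuous_on_id]],
            force)
          (rule continuous_on_compose2[OF cont[OF T[OF a(1)] Y'(3)] continuous_on_snd[OF continuous_on_id]],
            force)
      then show ?thesis
        by (simp add: a(2) P_def map_prod_def case_prod_unfold continuous_on_Pair)
    qed
    show "f ` (Y \<times> Y') \<subseteq> Y \<times> Y'" if "f \<in> P ` D" for f
    proof -
      obtain a where a: "a \<in> D" "f = P a" using \<open>f \<in> P ` D\<close> by blast
      show ?thesis using Y(4)[OF a(1)] Y'(4)[OF a(1)] by (auto simp: a(2) P_def)
    qed
  qed simp
  then obtain G where G: "compact G" "G \<noteq> {}" "G \<subseteq> Y \<times> Y'" "G = (\<Union>f\<in>P ` D. f ` G)"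
    unfolding is_attractor_def by blast
  have S': "\<exists>k<1. \<forall>x\<in>X. \<forall>y\<in>X. dist (f x) (f y) \<le> k * dist x y" if "f \<in> S ` D" for f
    using S that by (elim imageE) simp
  have T': "\<exists>k<1. \<forall>x\<in>X'. \<forall>y\<in>X'. dist (f x) (f y) \<le> k * dist x y" if "f \<in> T ` D" for f
    using T that by (elim imageE) simp
  have "is_attractor X (S ` D) (fst ` G)"
    unfolding is_attractor_def
  proof (intro conjI)
    show "compact (fst ` G)" by (intro compact_continuous_image continuous_intros G(1))
    have "fst ` G = (\<Union>a\<in>D. fst ` P a ` G)" by (subst G(4)) (simp add: image_UN)
    also have "\<dots> = (\<Union>f\<in>S ` D. f ` fst ` G)" by (simp add: P_def image_image)
    finally show "fst ` G = (\<Union>f\<in>S ` D. f ` fst ` G)" .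
    show "fst ` G \<subseteq> X" using G(3) Y(3) by force
  qed (use G(2) in simp)
  then have "fst ` G = L"
    using is_attractor_subset[OF _ L S'] is_attractor_subset[OF L _ S'] by blast
  have "is_attractor X' (T ` D) (snd ` G)"
    unfolding is_attractor_def
  proof (intro conjI)
    show "compact (snd ` G)" by (intro compact_continuous_image continuous_intros G(1))
    have "snd ` G = (\<Union>a\<in>D. snd ` P a ` G)" by (subst G(4)) (simp add: image_UN)
    also have "\<dots> = (\<Union>f\<in>T ` D. f ` snd ` G)" by (simp add: P_def image_image)
    finally show "snd ` G = (\<Union>f\<in>T ` D. f ` snd ` G)" .
    show "snd ` G \<subseteq> X'" using G(3) Y'(3) by force
  qed (use G(2) in simp)
  then have "snd ` G = K"
    using is_attractor_subset[OF _ K T'] is_attractor_subset[OF K _ T'] by blast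
  have "\<exists>a\<in>D. \<exists>(y, v)\<in>G. x = S a y \<and> u = T a v" if "(x, u) \<in> G" for x u
  proof -
    have "(x, u) \<in> (\<Union>f\<in>P ` D. f ` G)" using that G(4) by simp
    then show ?thesis by (auto simp: P_def)
  qed
  then show ?thesis using that G(3) \<open>fst ` G = L\<close> \<open>snd ` G = K\<close> by simp
qed

text \<open>
  The corner pairs are adjoined even if \<open>G\<close> does not reach the boundary, since they are the pairs to
  which boundary points are compared. They satisfy the coding condition because the
  first and the last cell map fix them.
\<close>

lemma coordinate_self_coded:
  fixes G :: "((real^'d) \<times> (real^'d::finite)) set"
  assumes c: "cut_points m c" and c': "cut_points m c'"
    and G: "G \<subseteq> unit_cube \<times> unit_cube"
    and coded: "\<And>x u. (x, u) \<in> G \<Longrightarrow>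
      \<exists>a<m. \<exists>(y, v)\<in>G. x $ i = cell_map c a (y $ i) \<and> u $ i = cell_map c' a (v $ i)"
  shows "self_coded m c c' ({(0, 0), (1, 1)} \<union> (\<lambda>(x, u). (x $ i, u $ i)) ` G)"
    (is "self_coded m c c' ?E")
  unfolding self_coded_def
proof (intro conjI ballI)
  have "p \<in> {0..1} \<times> {0..1}" if "p \<in> (\<lambda>(x, u). (x $ i, u $ i)) ` G" for p
    using that G by (auto simp: mem_unit_cube)
  then have "(\<lambda>(x, u). (x $ i, u $ i)) ` G \<subseteq> {0..1} \<times> {0..1}" by (rule subsetI)
  then show "?E \<subseteq> {0..1} \<times> {0..1}" by simp
  fix p assume "p \<in> ?E"
  have "0 < m" "m - 1 < m" "Suc (m - 1) = m" using c by (auto simp: cut_points_def)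
  moreover have "c 0 = 0" "c m = 1" "c' 0 = 0" "c' m = 1" using c c' by (auto simp: cut_points_def)
  ultimately have ends: "cell_map c 0 0 = 0" "cell_map c' 0 0 = 0"
    "cell_map c (m - 1) 1 = 1" "cell_map c' (m - 1) 1 = 1"
    by (simp_all add: cell_map_endpoints)
  consider "p = (0, 0)" | "p = (1, 1)" | x u where "(x, u) \<in> G" "p = (x $ i, u $ i)"
    using \<open>p \<in> ?E\<close> by auto
  then have "\<exists>a<m. \<exists>q\<in>?E. fst p = cell_map c a (fst q) \<and> snd p = cell_map c' a (snd q)"
  proof cases
    case 1
    show ?thesis
      by (intro exI[of _ 0] conjI bexI[of _ "(0, 0)"]) (use ends \<open>0 < m\<close> 1 in simp_all)
  next
    case 2
    show ?thesis
      by (intro exI[of _ "m - 1"] conjI bexI[of _ "(1, 1)"]) (use ends \<open>m - 1 < m\<close> 2 in simp_all)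
  next
    case 3
    obtain a y v where a: "a < m" "(y, v) \<in> G" "x $ i = cell_map c a (y $ i)" "u $ i = cell_map c' a (v $ i)"
      using coded[OF 3(1)] by blast
    have "(y $ i, v $ i) \<in> ?E" using imageI[OF a(2), of "\<lambda>(x, u). (x $ i, u $ i)"] by simp
    then show ?thesis
      by (intro exI[of _ a] conjI bexI[of _ "(y $ i, v $ i)"]) (use a 3(2) in simp_all)
  qed
  then show "case p of (x, u) \<Rightarrow> \<exists>a<m. \<exists>(y, v)\<in>?E. x = cell_map c a y \<and> u = cell_map c' a v"
    by (simp only: case_prod_unfold)
qed

section \<open>From coordinate estimates to a bi-Hoelder bijection\<close>

text \<open>As \<open>\<alpha>\<close> tends to 0, \<open>r powr \<alpha>\<close> tends to 1 and thus exceeds any given number below 1.\<close>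

lemma common_exponent:
  fixes l l' :: "'i \<Rightarrow> real"
  assumes I: "finite I" and l: "\<And>i. i \<in> I \<Longrightarrow> 0 < l i \<and> l i < 1"
    and l': "\<And>i. i \<in> I \<Longrightarrow> 0 < l' i \<and> l' i < 1"
  obtains \<alpha> where "0 < \<alpha>" "\<alpha> \<le> 1"
    "\<And>i. i \<in> I \<Longrightarrow> l' i \<le> l i powr \<alpha>" "\<And>i. i \<in> I \<Longrightarrow> l i \<le> l' i powr \<alpha>"
proof -
  have ev: "eventually (\<lambda>\<alpha>. s < r powr \<alpha>) (at_right 0)" if "0 < r" "s < 1" for r s :: real
  proof (rule order_tendstoD(1))
    show "((\<lambda>\<alpha>. r powr \<alpha>) \<longlongrightarrow> r powr 0) (at_right 0)"
      using that by (intro tendsto_intros) auto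
  qed (use that in simp)
  have "eventually (\<lambda>\<alpha>. \<forall>i\<in>I. l' i < l i powr \<alpha> \<and> l i < l' i powr \<alpha>) (at_right 0)"
    using l l' by (intro eventually_ball_finite[OF I] ballI eventually_conj ev) auto
  moreover have "eventually (\<lambda>\<alpha>::real. \<alpha> \<in> {0<..<1}) (at_right 0)"
    by (rule eventually_at_right_real) simp
  ultimately have "eventually (\<lambda>\<alpha>. (\<forall>i\<in>I. l' i < l i powr \<alpha> \<and> l i < l' i powr \<alpha>) \<and> \<alpha> \<in> {0<..<1}) (at_right 0)"
    by (rule eventually_conj)
  then obtain \<alpha> where "\<forall>i\<in>I. l' i < l i powr \<alpha> \<and> l i < l' i powr \<alpha>" "\<alpha> \<in> {0<..<1}"
    using eventually_happens'[OF trivial_limit_at_right_real] by blast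
  then show ?thesis by (intro that[of \<alpha>]) (auto intro: less_imp_le)
qed

lemma holder_componentwise:
  fixes x y u v :: "real^'d::finite"
  assumes C: "\<And>i. 0 \<le> C i" and \<alpha>: "0 \<le> \<alpha>"
    and le: "\<And>i. \<bar>u $ i - v $ i\<bar> \<le> C i * \<bar>x $ i - y $ i\<bar> powr \<alpha>"
  shows "dist u v \<le> (\<Sum>i\<in>UNIV. C i) * dist x y powr \<alpha>"
proof -
  have "dist u v \<le> (\<Sum>i\<in>UNIV. \<bar>(u - v) $ i\<bar>)"
    unfolding dist_norm by (rule norm_le_l1_cart)
  also have "\<dots> \<le> (\<Sum>i\<in>UNIV. C i * dist x y powr \<alpha>)"
  proof (rule sum_mono)
    fix i
    have "\<bar>x $ i - y $ i\<bar> \<le> dist x y"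
      using component_le_norm_cart[of "x - y" i] by (simp add: dist_norm)
    then have "C i * \<bar>x $ i - y $ i\<bar> powr \<alpha> \<le> C i * dist x y powr \<alpha>"
      using C \<alpha> by (intro mult_left_mono powr_mono2) auto
    then show "\<bar>(u - v) $ i\<bar> \<le> C i * dist x y powr \<alpha>" using le[of i] by simp
  qed
  finally show ?thesis by (simp add: sum_distrib_right)
qed

text \<open>
  The two estimates at distance 0 say that \<open>G\<close> is the graph of an injective function. Solving the
  second one for the distance of the images costs the power \<open>1 / \<alpha>\<close> of the constant.
\<close>

lemma bi_holder_graph:
  fixes G :: "('a::metric_space \<times> 'b::metric_space) set"
  assumes \<alpha>: "0 < \<alpha>" "\<alpha> \<le> 1"
    and A: "\<And>x u y v. (x, u) \<in> G \<Longrightarrow> (y, v) \<in> G \<Longrightarrow> dist u v \<le> A * dist x y powr \<alpha>"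
    and B: "\<And>x u y v. (x, u) \<in> G \<Longrightarrow> (y, v) \<in> G \<Longrightarrow> dist x y \<le> B * dist u v powr \<alpha>"
  shows "\<exists>F. (\<forall>x\<in>fst ` G. (x, F x) \<in> G) \<and> bij_betw F (fst ` G) (snd ` G) \<and>
    bi_holder_on (fst ` G) F"
proof -
  define F where "F = (\<lambda>x. SOME u. (x, u) \<in> G)"
  have F: "(x, F x) \<in> G" if x: "x \<in> fst ` G" for x
  proof -
    obtain u where "(x, u) \<in> G" using x by auto
    then show ?thesis unfolding F_def by (rule someI)
  qed
  have fun_eq: "u = v" if "(x, u) \<in> G" "(x, v) \<in> G" for x u v
    using A[OF that] by simp
  have inj_eq: "x = y" if "(x, u) \<in> G" "(y, u) \<in> G" for x y u
    using B[OF that] by simp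
  have bij: "bij_betw F (fst ` G) (snd ` G)"
    unfolding bij_betw_def
  proof
    show "inj_on F (fst ` G)"
      using F inj_eq by (intro inj_onI) metis
    show "F ` fst ` G = snd ` G"
    proof (intro equalityI subsetI)
      fix u assume "u \<in> F ` fst ` G"
      then obtain x where x: "x \<in> fst ` G" "u = F x" by blast
      show "u \<in> snd ` G" using imageI[OF F[OF x(1)], of snd] x(2) by simp
    next
      fix u assume "u \<in> snd ` G"
      then obtain x where x: "(x, u) \<in> G" by auto
      then have x1: "x \<in> fst ` G" by force
      show "u \<in> F ` fst ` G" using fun_eq[OF F[OF x1] x] x1 by blast
    qed
  qed
  define C where "C = max 1 (max A B)"
  have C: "1 \<le> C" "A \<le> C" "B \<le> C" by (auto simp: C_def)
  have inv: "1 \<le> 1 / \<alpha>" using \<alpha> by simp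
  have "C powr 1 \<le> C powr (1 / \<alpha>)" using inv C(1) by (rule powr_mono)
  then have CC: "C \<le> C powr (1 / \<alpha>)" using C(1) by simp
  have "bi_holder_on (fst ` G) F"
    unfolding bi_holder_on_def
  proof (rule exI[of _ "C powr (1 / \<alpha>)"], rule exI[of _ \<alpha>], intro conjI ballI)
    show "1 \<le> C powr (1 / \<alpha>)" using C(1) CC by linarith
    fix x y assume xy: "x \<in> fst ` G" "y \<in> fst ` G"
    note G = F[OF xy(1)] F[OF xy(2)]
    have "A * dist x y powr \<alpha> \<le> C powr (1 / \<alpha>) * dist x y powr \<alpha>"
      using C(2) CC by (intro mult_right_mono) auto
    then show "dist (F x) (F y) \<le> C powr (1 / \<alpha>) * dist x y powr \<alpha>" using A[OF G] by linarith
    have "B * dist (F x) (F y) powr \<alpha> \<le> C * dist (F x) (F y) powr \<alpha>"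
      using C(3) by (intro mult_right_mono) auto
    then have "dist x y powr (1 / \<alpha>) \<le> (C * dist (F x) (F y) powr \<alpha>) powr (1 / \<alpha>)"
      using B[OF G] \<alpha>(1) by (intro powr_mono2) auto
    also have "\<dots> = C powr (1 / \<alpha>) * dist (F x) (F y)"
      using C(1) \<alpha>(1) by (simp add: powr_mult powr_powr)
    finally show "inverse (C powr (1 / \<alpha>)) * dist x y powr (1 / \<alpha>) \<le> dist (F x) (F y)"
      using C(1) by (simp add: field_simps)
  qed (use \<alpha> in auto)
  then show ?thesis using F bij by blast
qed

section \<open>The bijection between the sponges\<close>

lemma uniform_cut_points:
  assumes "2 \<le> m"
  shows "cut_points m (\<lambda>a. real a / real m)"
    and "cell_map (\<lambda>a. real a / real m) a x = (x + real a) / real m"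
  using assms by (simp_all add: cut_points_def cell_map_def divide_strict_right_mono field_simps)

lemma mem_frontier_unit_cube:
  "x \<in> frontier unit_cube \<longleftrightarrow> x \<in> unit_cube \<and> (\<exists>i. x $ i = 0 \<or> x $ i = 1)"
  for x :: "real^'d::finite"
  by (auto simp: frontier_cbox mem_box_cart order.strict_iff_order)

theorem theorem1p1:
  fixes n :: "'d::finite \<Rightarrow> nat"
    and \<phi> :: "'d \<Rightarrow> nat \<Rightarrow> real \<Rightarrow> real"
    and D :: "(nat^'d) set"
  assumes "slicing_ifs n \<phi> D"
  shows "\<exists>F :: real^'d \<Rightarrow> real^'d.
           bij_betw F (slicing_sponge \<phi> D) (sierpinski_sponge (diag_matrix n) D) \<and>
           bi_holder_on (slicing_sponge \<phi> D) F \<and>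
           F ` (slicing_sponge \<phi> D \<inter> frontier unit_cube) \<subseteq> frontier unit_cube"
proof -
  have n2: "2 \<le> n i" for i using assms by (simp add: slicing_ifs_def slicing_system_def)
  then have n0: "0 < n i" for i by (metis not_gr_zero not_numeral_le_zero)
  have digit: "a $ i < n i" if "a \<in> D" for a i
    using assms that by (auto simp: slicing_ifs_def)
  have "\<exists>c. cut_points (n i) c \<and> (\<forall>a x. a < n i \<longrightarrow> x \<in> {0..1} \<longrightarrow> \<phi> i a x = cell_map c a x)" for i
  proof -
    have "slicing_system (n i) (\<phi> i)" using assms by (simp add: slicing_ifs_def)
    then show ?thesis by (rule slicing_system_cut_points) blast
  qed
  then obtain c where c: "\<And>i. cut_points (n i) (c i)"
    and \<phi>: "\<And>i a x. a < n i \<Longrightarrow> x \<in> {0..1} \<Longrightarrow> \<phi> i a x = cell_map (c i) a x"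
    by metis
  define c' where "c' = (\<lambda>i a. real a / real (n i))"
  have c': "cut_points (n i) (c' i)" for i
    unfolding c'_def by (rule uniform_cut_points(1)[OF n2])
  let ?S = "slicing_map \<phi>" and ?T = "sierpinski_map (diag_matrix n)"
  let ?L = "slicing_sponge \<phi> D" and ?K = "sierpinski_sponge (diag_matrix n) D"
  have S: "?S a x $ i = cell_map (c i) (a $ i) (x $ i)" if "a \<in> D" "x \<in> unit_cube" for a x i
    using \<phi>[OF digit[OF that(1)], of "x $ i" i] that(2) by (simp add: slicing_map_def mem_unit_cube)
  have T: "?T a x $ i = cell_map (c' i) (a $ i) (x $ i)" for a x i
    unfolding c'_def sierpinski_map_component[OF n0] uniform_cut_points(2)[OF n2] ..
  obtain G where G: "G \<subseteq> unit_cube \<times> unit_cube" "fst ` G = ?L" "snd ` G = ?K"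
    "\<And>x u. (x, u) \<in> G \<Longrightarrow> \<exists>a\<in>D. \<exists>(y, v)\<in>G. x = ?S a y \<and> u = ?T a v"
  proof (rule attractor_coupling[OF finite_digits[OF assms] is_attractor_slicing_sponge[OF assms]
        is_attractor_sierpinski_sponge[OF assms], where Y = unit_cube and Y' = unit_cube])
    fix a assume a: "a \<in> D"
    show "\<exists>k<1. \<forall>x\<in>unit_cube. \<forall>y\<in>unit_cube. dist (?S a x) (?S a y) \<le> k * dist x y"
      by (rule cell_product_contraction[OF c digit[OF a] S[OF a]])
    show "\<exists>k<1. \<forall>x\<in>UNIV. \<forall>y\<in>UNIV. dist (?T a x) (?T a y) \<le> k * dist x y"
      by (rule cell_product_contraction[OF c' digit[OF a] T])
    show "?S a ` unit_cube \<subseteq> unit_cube"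
      by (rule cell_product_unit_cube[OF c digit[OF a] S[OF a]])
    show "?T a ` unit_cube \<subseteq> unit_cube"
      by (rule cell_product_unit_cube[OF c' digit[OF a] T])
  qed (use unit_cube_ne compact_cbox in auto)
  define E where "E = (\<lambda>i. {(0, 0), (1, 1)} \<union> (\<lambda>(x, u). (x $ i, u $ i)) ` G)"
  have E: "self_coded (n i) (c i) (c' i) (E i)" for i
    unfolding E_def
  proof (rule coordinate_self_coded[OF c c' G(1)])
    fix x u assume "(x, u) \<in> G"
    then obtain a y v where a: "a \<in> D" "(y, v) \<in> G" "x = ?S a y" "u = ?T a v"
      using G(4) by blast
    have "y \<in> unit_cube" using a(2) G(1) by blast
    then show "\<exists>b<n i. \<exists>(y, v)\<in>G. x $ i = cell_map (c i) b (y $ i) \<and> u $ i = cell_map (c' i) b (v $ i)"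
      using digit[OF a(1), of i] a(2) S[OF a(1), of y i] T[of a v i]
      by (intro exI[of _ "a $ i"] conjI bexI[of _ "(y, v)"]) (simp_all add: a(3,4))
  qed
  have inE: "(x $ i, u $ i) \<in> E i" if "(x, u) \<in> G" for x u i
    using imageI[OF that, of "\<lambda>(x, u). (x $ i, u $ i)"] by (simp add: E_def)
  obtain \<alpha> where \<alpha>: "0 < \<alpha>" "\<alpha> \<le> 1"
    and scale: "\<And>i a. a < n i \<Longrightarrow> gap (c' i) a \<le> gap (c i) a powr \<alpha>"
    and scale': "\<And>i a. a < n i \<Longrightarrow> gap (c i) a \<le> gap (c' i) a powr \<alpha>"
  proof (rule common_exponent[of "SIGMA i : UNIV. {..<n i}" "\<lambda>(i, a). gap (c i) a" "\<lambda>(i, a). gap (c' i) a"])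
    show "finite (SIGMA i : UNIV. {..<n i})" by simp
    fix p assume "p \<in> (SIGMA i : UNIV. {..<n i})"
    then obtain i a where p: "p = (i, a)" "a < n i" by auto
    show "0 < (case p of (i, a) \<Rightarrow> gap (c i) a) \<and> (case p of (i, a) \<Rightarrow> gap (c i) a) < 1"
      using cut_points_gap[OF c p(2)] by (simp add: p(1))
    show "0 < (case p of (i, a) \<Rightarrow> gap (c' i) a) \<and> (case p of (i, a) \<Rightarrow> gap (c' i) a) < 1"
      using cut_points_gap[OF c' p(2)] by (simp add: p(1))
  qed fastforce
  have "\<exists>C\<ge>0. \<forall>x u y v. (x, u) \<in> E i \<longrightarrow> (y, v) \<in> E i \<longrightarrow> \<bar>u - v\<bar> \<le> C * \<bar>x - y\<bar> powr \<alpha>" for i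
    by (rule self_coded_holder[OF c c' E \<alpha>(1) scale]) blast+
  then obtain A where A: "\<And>i. 0 \<le> A i"
    "\<And>i x u y v. (x, u) \<in> E i \<Longrightarrow> (y, v) \<in> E i \<Longrightarrow> \<bar>u - v\<bar> \<le> A i * \<bar>x - y\<bar> powr \<alpha>"
    by metis
  have "\<exists>C\<ge>0. \<forall>x u y v. (x, u) \<in> E i \<longrightarrow> (y, v) \<in> E i \<longrightarrow> \<bar>x - y\<bar> \<le> C * \<bar>u - v\<bar> powr \<alpha>" for i
    by (rule self_coded_holder[OF c' c self_coded_converse[OF E] \<alpha>(1) scale']) blast+
  then obtain B where B: "\<And>i. 0 \<le> B i"
    "\<And>i x u y v. (x, u) \<in> E i \<Longrightarrow> (y, v) \<in> E i \<Longrightarrow> \<bar>x - y\<bar> \<le> B i * \<bar>u - v\<bar> powr \<alpha>"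
    by metis
  have "\<exists>F. (\<forall>x\<in>fst ` G. (x, F x) \<in> G) \<and> bij_betw F (fst ` G) (snd ` G) \<and>
    bi_holder_on (fst ` G) F"
  proof (rule bi_holder_graph[OF \<alpha>, of G "\<Sum>i\<in>UNIV. A i" "\<Sum>i\<in>UNIV. B i"])
    fix x u y v assume xu: "(x, u) \<in> G" and yv: "(y, v) \<in> G"
    show "dist u v \<le> (\<Sum>i\<in>UNIV. A i) * dist x y powr \<alpha>"
      using \<alpha>(1) A(2)[OF inE[OF xu] inE[OF yv]] by (intro holder_componentwise A(1)) auto
    show "dist x y \<le> (\<Sum>i\<in>UNIV. B i) * dist u v powr \<alpha>"
      using \<alpha>(1) B(2)[OF inE[OF xu] inE[OF yv]] by (intro holder_componentwise B(1)) auto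
  qed
  then obtain F where F: "\<forall>x\<in>fst ` G. (x, F x) \<in> G" "bij_betw F (fst ` G) (snd ` G)"
    "bi_holder_on (fst ` G) F"
    by blast
  have "F x \<in> frontier unit_cube" if x: "x \<in> ?L \<inter> frontier unit_cube" for x
  proof -
    have xF: "(x, F x) \<in> G" using x F(1) G(2) by blast
    obtain i where i: "x $ i = 0 \<or> x $ i = 1" using x by (auto simp: mem_frontier_unit_cube)
    have ends: "(0, 0) \<in> E i" "(1, 1) \<in> E i" by (simp_all add: E_def)
    have "F x $ i = 0 \<or> F x $ i = 1"
      using i A(2)[OF inE[OF xF] ends(1)] A(2)[OF inE[OF xF] ends(2)] by auto
    then show ?thesis using xF G(1) by (auto simp: mem_frontier_unit_cube)
  qed
  then show ?thesis
    using F(2,3) unfolding G(2,3) by (intro exI[of _ F]) blast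
qed

end
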